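(* Let $G$ be a finite group. Then $|c(G)|=6$ if and only if there exist distinct primes $p$ and $q$ with $p<q$ such that $G$ is isomorphic to one of $C_{p^5}$, $C_{p^2q}$, $C_{pq^2}$, or $C_2\times C_4$.
   Context: For a finite group $G$, $c(G)$ denotes the set of all cyclic subgroups of $G$ (including the trivial subgroup), so $|c(G)|$ is the number of cyclic subgroups of $G$. $C_n$ denotes the cyclic group of order $n$. *)

theory Defs
  imports "HOL-Algebra.Algebra"
begin

definition cyclic_subgroups :: "('a, 'b) monoid_scheme \<Rightarrow> 'a set set" where
  "cyclic_subgroups G = {H. subgroup H G \<and> cyclic_group (G\<lparr>carrier := H\<rparr>)}"

end

theory Submission
  imports Defs "HOL-Number_Theory.Totient"
begin

text \<open>
  An element of order \<open>n\<close> shares its cyclic subgroup with \<open>\<phi>(n)\<close> elements, so the number of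
  cyclic subgroups is \<open>\<Sum>x. 1 / \<phi>(ord x)\<close>. Let \<open>M = \<langle>a\<rangle>\<close> be a cyclic subgroup of maximal order \<open>m\<close>,
  let \<open>d\<close> be the number of divisors of \<open>m\<close> and \<open>t\<close> the index of \<open>M\<close>. The elements of \<open>M\<close> contribute \<open>d\<close>,
  so the \<open>(t - 1) m\<close> remaining ones contribute \<open>6 - d\<close>. If \<open>i\<close> is the least positive
  exponent with \<open>x\<^sup>i \<in> M\<close>, where \<open>x \<notin> M\<close>, then \<open>i \<le> t\<close> and \<open>ord x = i s\<close> for a proper divisor \<open>s\<close> of \<open>m\<close>;
  this bounds \<open>\<phi>(ord x)\<close> and leaves, for \<open>t > 1\<close>, only the cases \<open>(m, t) = (2, 3), (4, 2), (8, 2), (9, 3)\<close>.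
  The first contradicts Cauchy's theorem. In the last two every element outside \<open>M\<close> would have
  order \<open>m\<close>, but \<open>a\<close> is conjugated by \<open>x\<close> to a power of itself, and an explicit \<open>a\<^sup>n x\<close> has smaller order.
  The case \<open>(4, 2)\<close> gives \<open>C\<^sub>2 \<times> C\<^sub>4\<close>.
\<close>

section \<open>Divisor counts and a bound on the totient\<close>

text \<open>A divisor is \<open>p ^ i * e\<close> for exactly one pair with \<open>i \<le> k\<close>
  and \<open>e dvd b\<close>: as \<open>p\<close> does not divide \<open>e\<close>, the exponent
  \<open>i\<close> is the multiplicity of \<open>p\<close>, and cancelling determines
  \<open>e\<close>.\<close>

lemma card_divisors_prime_power_mult:
  fixes p b k :: nat
  assumes "Factorial_Ring.prime p" "\<not> p dvd b" "b > 0"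
  shows "card {d. d dvd p ^ k * b} = (k + 1) * card {d. d dvd b}"
proof -
  have cop: "coprime (p ^ k) b"
    using assms by (simp add: prime_imp_coprime)
  have "bij_betw (\<lambda>(i, e). p ^ i * e) ({..k} \<times> {d. d dvd b}) {d. d dvd p ^ k * b}"
  proof (rule bij_betw_imageI)
    show "inj_on (\<lambda>(i, e). p ^ i * e) ({..k} \<times> {d. d dvd b})"
    proof (clarsimp simp: inj_on_def)
      fix i e j f assume "e dvd b" "f dvd b" and eq: "p ^ i * e = p ^ j * f"
      then have ndvd: "\<not> p dvd e" "\<not> p dvd f" using assms(2) dvd_trans by blast+
      have "multiplicity p (p ^ i * e) = i" "multiplicity p (p ^ j * f) = j"
        using ndvd assms(1) by (auto simp: multiplicity_decomposeI)
      with eq have "i = j" by simp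
      then show "i = j \<and> e = f" using eq assms(1) by (auto simp: prime_gt_0_nat)
    qed
    show "(\<lambda>(i, e). p ^ i * e) ` ({..k} \<times> {d. d dvd b}) = {d. d dvd p ^ k * b}"
    proof (intro equalityI subsetI)
      fix y assume "y \<in> {d. d dvd p ^ k * b}"
      then obtain u v where "y = u * v" "u dvd p ^ k" "v dvd b"
        using division_decomp by blast
      then show "y \<in> (\<lambda>(i, e). p ^ i * e) ` ({..k} \<times> {d. d dvd b})"
        using assms(1) by (force simp: divides_primepow_nat)
    qed (auto simp: le_imp_power_dvd mult_dvd_mono)
  qed
  from bij_betw_same_card[OF this] show ?thesis by (simp add: card_cartesian_product)
qed

text \<open>Splitting off the full power of one prime makes \<open>k + 1\<close> a factor of the
  divisor count, so a small count leaves few choices of \<open>k\<close>.\<close>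

lemma prime_power_decompose:
  fixes n :: nat
  assumes "n > 1"
  obtains p k b where "Factorial_Ring.prime p" "\<not> p dvd b" "b > 0" "k > 0" "n = p ^ k * b"
    "card {d. d dvd n} = (k + 1) * card {d. d dvd b}"
proof -
  obtain p where p: "Factorial_Ring.prime p" "p dvd n"
    using assms prime_factor_nat[of n] by auto
  obtain b where b: "n = p ^ multiplicity p n * b" "\<not> p dvd b"
    using multiplicity_decompose'[of n p] assms p by (metis not_one_less_zero not_prime_unit)
  have "multiplicity p n > 0"
    using p assms by (simp add: prime_multiplicity_gt_zero_iff)
  moreover have "b > 0" using b assms by (cases b) auto
  ultimately show ?thesis
    using that[of p b "multiplicity p n"] p b card_divisors_prime_power_mult[OF p(1) b(2)] by metis
qed

lemma card_divisors_eq_1_iff: "card {d. d dvd n} = Suc 0 \<longleftrightarrow> n = Suc 0" for n :: nat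
proof
  assume "card {d. d dvd n} = Suc 0"
  then obtain x where x: "{d. d dvd n} = {x}" by (auto simp: card_1_singleton_iff)
  have "1 \<in> {d. d dvd n}" "n \<in> {d. d dvd n}" by auto
  then show "n = Suc 0" unfolding x by simp
qed auto

lemma card_divisors_eq_2D:
  fixes n :: nat
  assumes "card {d. d dvd n} = 2"
  shows "Factorial_Ring.prime n"
proof -
  have "n > 1" using assms by (cases "n = 0"; cases "n = 1") auto
  from prime_power_decompose[OF this] obtain p k b where
    *: "Factorial_Ring.prime p" "k > 0" "n = p ^ k * b" "(k + 1) * card {d. d dvd b} = 2"
    using assms by metis
  from *(4) have "k + 1 dvd 2" by (metis dvd_triv_left)
  then have "k + 1 \<le> 2" by (rule dvd_imp_le) simp
  with *(2) have "k = 1" by simp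
  with *(4) have "card {d. d dvd b} = 1" by simp
  then show ?thesis using * \<open>k = 1\<close> by (simp add: card_divisors_eq_1_iff)
qed

lemma card_divisors_eq_3D:
  fixes n :: nat
  assumes "card {d. d dvd n} = 3"
  obtains p where "Factorial_Ring.prime p" "n = p ^ 2"
proof -
  have "n > 1" using assms by (cases "n = 0"; cases "n = 1") auto
  from prime_power_decompose[OF this] obtain p k b where
    *: "Factorial_Ring.prime p" "k > 0" "n = p ^ k * b" "(k + 1) * card {d. d dvd b} = 3"
    using assms by metis
  from *(4) have "k + 1 dvd 3" by (metis dvd_triv_left)
  then have "k + 1 \<le> 3" by (rule dvd_imp_le) simp
  with * have "k = 1 \<or> k = 2" by auto
  with *(4) have "k = 2 \<and> card {d. d dvd b} = 1" by (elim disjE; hypsubst; presburger)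
  then show ?thesis using * that by (simp add: card_divisors_eq_1_iff)
qed

lemma card_divisors_eq_4D:
  fixes n :: nat
  assumes "card {d. d dvd n} = 4"
  obtains p where "Factorial_Ring.prime p" "n = p ^ 3"
  | p q where "Factorial_Ring.prime p" "Factorial_Ring.prime q" "p \<noteq> q" "n = p * q"
proof -
  have "n > 1" using assms by (cases "n = 0"; cases "n = 1") auto
  from prime_power_decompose[OF this] obtain p k b where
    *: "Factorial_Ring.prime p" "\<not> p dvd b" "k > 0" "n = p ^ k * b" "(k + 1) * card {d. d dvd b} = 4"
    using assms by metis
  from *(5) have "k + 1 dvd 4" by (metis dvd_triv_left)
  then have "k + 1 \<le> 4" by (rule dvd_imp_le) simp
  with * have "k = 1 \<or> k = 2 \<or> k = 3" by auto
  with *(5) consider "k = 3" "card {d. d dvd b} = 1" | "k = 1" "card {d. d dvd b} = 2"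
    by atomize_elim (elim disjE; hypsubst; presburger)
  then show ?thesis
  proof cases
    case 1 then show ?thesis using * that(1) by (simp add: card_divisors_eq_1_iff)
  next
    case 2
    moreover have "p \<noteq> b" using *(2) by auto
    ultimately show ?thesis using * that(2)[of p b] card_divisors_eq_2D[of b] by simp
  qed
qed

lemma card_divisors_eq_6D:
  fixes n :: nat
  assumes "card {d. d dvd n} = 6"
  obtains p where "Factorial_Ring.prime p" "n = p ^ 5"
  | p q where "Factorial_Ring.prime p" "Factorial_Ring.prime q" "p \<noteq> q" "n = p ^ 2 * q"
proof -
  have "n > 1" using assms by (cases "n = 0"; cases "n = 1") auto
  from prime_power_decompose[OF this] obtain p k b where
    *: "Factorial_Ring.prime p" "\<not> p dvd b" "k > 0" "n = p ^ k * b" "(k + 1) * card {d. d dvd b} = 6"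
    using assms by metis
  from *(5) have "k + 1 dvd 6" by (metis dvd_triv_left)
  then have "k + 1 \<le> 6" by (rule dvd_imp_le) simp
  with * have "k = 1 \<or> k = 2 \<or> k = 3 \<or> k = 4 \<or> k = 5" by auto
  \<comment> \<open>\<open>4\<close> and \<open>5\<close> do not divide \<open>6\<close>, which
    excludes \<open>k = 3\<close> and \<open>k = 4\<close>.\<close>
  with *(5) consider "k = 5" "card {d. d dvd b} = 1" | "k = 2" "card {d. d dvd b} = 2"
    | "k = 1" "card {d. d dvd b} = 3"
    by atomize_elim (elim disjE; hypsubst; presburger)
  then show ?thesis
  proof cases
    case 1 then show ?thesis using * that(1) by (simp add: card_divisors_eq_1_iff)
  next
    case 2
    moreover have "p \<noteq> b" using *(2) by auto
    ultimately show ?thesis using * that(2)[of p b] card_divisors_eq_2D[of b] by simp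
  next
    case 3
    then obtain q where q: "Factorial_Ring.prime q" "b = q ^ 2" using card_divisors_eq_3D by blast
    \<comment> \<open>The square now sits on \<open>q\<close>, so the two primes exchange
      roles.\<close>
    then show ?thesis using * 3 that(2)[of q p] by (cases "p = q") (auto simp: mult.commute)
  qed
qed

lemma card_divisors_prime_power_5:
  "card {d. d dvd p ^ 5} = 6" if "Factorial_Ring.prime p" for p :: nat
  using card_divisors_prime_power_mult[of p 1 5] that prime_gt_1_nat[of p] by simp

lemma card_divisors_prime_square_mult_prime:
  fixes p q :: nat
  assumes "Factorial_Ring.prime p" "Factorial_Ring.prime q" "p \<noteq> q"
  shows "card {d. d dvd p ^ 2 * q} = 6"
proof -
  have q: "card {d. d dvd q} = 2"
    using card_divisors_prime_power_mult[of q 1 1] assms prime_gt_1_nat[of q] by simp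
  have "\<not> p dvd q" using assms primes_dvd_imp_eq by blast
  then show ?thesis using card_divisors_prime_power_mult[of p q 2] q assms(1,2)
    by (simp add: prime_gt_0_nat)
qed

text \<open>The \<open>s\<close> multiples of \<open>p\<close> up to \<open>p * s\<close> are not
  totatives. The bound covers \<open>p\<close> dividing \<open>s\<close> as well.\<close>

lemma totient_prime_mult_le:
  fixes p s :: nat
  assumes "Factorial_Ring.prime p" "s > 0"
  shows "totient (p * s) \<le> (p - 1) * s"
proof -
  let ?A = "(\<lambda>j. p * j) ` {1..s}"
  have p: "p > 1" using assms prime_gt_1_nat by blast
  have A: "card ?A = s" using p by (subst card_image) (auto simp: inj_on_def)
  have "totatives (p * s) \<inter> ?A = {}"
    using p by (auto simp: totatives_def coprime_mult_left_iff coprime_mult_right_iff)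
  moreover have "totatives (p * s) \<union> ?A \<subseteq> {1..p * s}"
    using p by (auto simp: totatives_def)
  ultimately have "card (totatives (p * s)) + card ?A \<le> p * s"
    by (metis card_Un_disjoint card_atLeastAtMost card_mono diff_Suc_1 finite_atLeastAtMost
        finite_totatives finite_imageI)
  then show ?thesis using A by (simp add: totient_def diff_mult_distrib)
qed

section \<open>Cyclic subgroups counted through element orders\<close>

context group
begin

text \<open>With \<open>n = ord x\<close>, the power \<open>x [^] k\<close> has order
  \<open>n div gcd k n\<close>. Elements of order \<open>e\<close> thus match the exponents
  \<open>k\<close> in \<open>{0<..n}\<close> with \<open>gcd k n = n div e\<close>, and there are
  \<open>totient e\<close> of these.\<close>

lemma card_generate_ord_eq:
  assumes "finite (carrier G)" "x \<in> carrier G" "e dvd ord x"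
  shows "card {y \<in> generate G {x}. ord y = e} = totient e"
proof -
  let ?n = "ord x"
  have n: "?n > 0" using assms ord_ge_1 by force
  from assms(3) n have e: "e > 0" "?n div e dvd ?n" "?n div (?n div e) = e" "?n div e > 0"
    by (auto simp: dvd_div_mult_self intro: Nat.gr0I) 
  have inj: "inj_on (\<lambda>k. x [^] k) {0<..?n}"
    using ord_inj'[OF assms(2)] by (simp add: atLeastSucAtMost_greaterThanAtMost[symmetric])
  have gen: "generate G {x} = (\<lambda>k. x [^] k) ` {0<..?n}"
  proof (rule card_subset_eq[symmetric])
    show "finite (generate G {x})"
      using assms generate_incl[of "{x}"] finite_subset by blast
    show "(\<lambda>k. x [^] k) ` {0<..?n} \<subseteq> generate G {x}"
      using generate_pow_on_finite_carrier[OF assms(1,2)] by blast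
    show "card ((\<lambda>k. x [^] k) ` {0<..?n}) = card (generate G {x})"
      using inj generate_pow_card[OF assms(2)] by (simp add: card_image)
  qed
  have "ord (x [^] k) = e \<longleftrightarrow> gcd k ?n = ?n div e" if "k \<in> {0<..?n}" for k
  proof -
    have "ord (x [^] k) = ?n div gcd k ?n"
      using that ord_pow_gen[OF assms(2)] by (simp add: gcd.commute)
    moreover obtain c where c: "?n = gcd k ?n * c" using gcd_dvd2 by blast
    moreover obtain f where f: "?n = e * f" using assms(3) by blast
    ultimately have "ord (x [^] k) = c" "?n div e = f"
      using n by (metis nonzero_mult_div_cancel_left mult_0 not_gr0)+
    moreover have "c = e \<longleftrightarrow> gcd k ?n = f"
      using c f n by (metis mult.commute mult_cancel_left mult_0 not_gr0)
    ultimately show ?thesis by simp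
  qed
  then have "{y \<in> generate G {x}. ord y = e} = (\<lambda>k. x [^] k) ` {k \<in> {0<..?n}. gcd k ?n = ?n div e}"
    unfolding gen by blast
  then have "card {y \<in> generate G {x}. ord y = e} = card {k \<in> {0<..?n}. gcd k ?n = ?n div e}"
    by (auto intro!: card_image inj_on_subset[OF inj])
  then show ?thesis using card_gcd_eq_totient[OF n e(2)] e by simp
qed

lemma ord_dvd_ord_generator:
  assumes "x \<in> carrier G" "y \<in> generate G {x}"
  shows "ord y dvd ord x"
proof -
  obtain k :: int where k: "y = x [^] k" using assms generate_pow by auto
  have "y [^] ord x = (x [^] k) [^] int (ord x)" by (simp add: k int_pow_int)
  also have "\<dots> = (x [^] int (ord x)) [^] k"
    using assms(1) by (simp add: int_pow_pow mult.commute)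
  also have "\<dots> = \<one>" using assms(1) by (simp add: int_pow_int)
  finally show ?thesis using assms k by (simp add: pow_eq_id)
qed

text \<open>The order of an element is the size of the subgroup it generates, so an inclusion
  between finite subgroups of equal size is an equality.\<close>

lemma generate_eq_iff:
  assumes "finite (carrier G)" "x \<in> carrier G" "y \<in> carrier G"
  shows "generate G {y} = generate G {x} \<longleftrightarrow> y \<in> generate G {x} \<and> ord y = ord x"
proof
  assume eq: "generate G {y} = generate G {x}"
  then show "y \<in> generate G {x} \<and> ord y = ord x"
    using generate.incl[of y "{y}" G] generate_pow_card assms by simp
next
  assume *: "y \<in> generate G {x} \<and> ord y = ord x"
  have "generate G {y} \<subseteq> generate G {x}"
    using * assms generate_is_subgroup[of "{x}"] by (intro generate_subgroup_incl) auto
  moreover have "finite (generate G {x})"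
    using assms generate_incl[of "{x}"] finite_subset by blast
  ultimately show "generate G {y} = generate G {x}"
    using * generate_pow_card assms by (metis card_subset_eq)
qed

text \<open>Powers taken in \<open>H\<close> and in \<open>G\<close> agree, so generating the
  restricted group means generating \<open>H\<close> inside \<open>G\<close>. This moves the count
  from subgroups to elements.\<close>

lemma cyclic_subgroups_eq: "cyclic_subgroups G = (\<lambda>x. generate G {x}) ` carrier G"
proof (intro equalityI subsetI)
  fix H assume "H \<in> cyclic_subgroups G"
  then have H: "subgroup H G" "cyclic_group (G\<lparr>carrier := H\<rparr>)" by (auto simp: cyclic_subgroups_def)
  interpret H: group "G\<lparr>carrier := H\<rparr>" using H subgroup.subgroup_is_group is_group by blast
  from H(2) obtain x where x: "x \<in> H" "H = range (\<lambda>n::int. x [^]\<^bsub>G\<lparr>carrier := H\<rparr>\<^esub> n)"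
    using H.cyclic_group by auto
  then have "H = range (\<lambda>n::int. x [^] n)" using int_pow_consistent[OF H(1)] by simp
  moreover have "x \<in> carrier G" using x H subgroup.subset by blast
  ultimately show "H \<in> (\<lambda>x. generate G {x}) ` carrier G"
    using generate_pow[of x] by (auto simp: full_SetCompr_eq)
next
  fix H assume "H \<in> (\<lambda>x. generate G {x}) ` carrier G"
  then obtain x where x: "x \<in> carrier G" "H = generate G {x}" by blast
  have H: "subgroup H G" using x generate_is_subgroup by simp
  interpret H: group "G\<lparr>carrier := H\<rparr>" using H subgroup.subgroup_is_group is_group by blast
  have "x \<in> H" using x generate.incl by fast
  moreover have "H = range (\<lambda>n::int. x [^]\<^bsub>G\<lparr>carrier := H\<rparr>\<^esub> n)"
    using x generate_pow[of x] int_pow_consistent[OF H \<open>x \<in> H\<close>] by (auto simp: full_SetCompr_eq)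
  ultimately show "H \<in> cyclic_subgroups G"
    using H H.cyclic_group by (auto simp: cyclic_subgroups_def)
qed

text \<open>The elements generating \<open>H = generate G {x}\<close> are those of \<open>H\<close>
  with the order of \<open>x\<close>; there are \<open>totient (ord x)\<close> of them, so their
  reciprocals add up to 1.\<close>

lemma card_cyclic_subgroups:
  assumes "finite (carrier G)"
  shows "real (card (cyclic_subgroups G)) = (\<Sum>x\<in>carrier G. 1 / totient (ord x))"
proof -
  have "(\<Sum>x\<in>carrier G. 1 / totient (ord x)) =
     (\<Sum>H\<in>cyclic_subgroups G. \<Sum>x\<in>{x\<in>carrier G. generate G {x} = H}. 1 / totient (ord x))"
    unfolding cyclic_subgroups_eq using assms by (rule sum.image_gen)
  also have "\<dots> = (\<Sum>H\<in>cyclic_subgroups G. 1)"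
  proof (rule sum.cong[OF refl])
    fix H assume "H \<in> cyclic_subgroups G"
    then obtain x where x: "x \<in> carrier G" "H = generate G {x}" by (auto simp: cyclic_subgroups_eq)
    have sub: "generate G {x} \<subseteq> carrier G" using generate_incl x by simp
    have "{y\<in>carrier G. generate G {y} = H} = {y \<in> generate G {x}. ord y = ord x}"
      using generate_eq_iff[OF assms x(1)] x sub by auto
    moreover have "totient (ord x) > 0" using assms x ord_ge_1 by force
    ultimately show "(\<Sum>y\<in>{y\<in>carrier G. generate G {y} = H}. 1 / totient (ord y)) = (1::real)"
      using card_generate_ord_eq[OF assms x(1), of "ord x"] by simp
  qed
  finally show ?thesis by simp
qed

text \<open>Grouped by order, the \<open>totient d\<close> elements of order \<open>d\<close>
  contribute 1 for every divisor \<open>d\<close> of \<open>ord a\<close>.\<close>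

lemma sum_generate_inverse_totient:
  assumes "finite (carrier G)" "a \<in> carrier G"
  shows "(\<Sum>x\<in>generate G {a}. 1 / totient (ord x)) = real (card {d. d dvd ord a})"
proof -
  have pos: "ord a > 0" using assms ord_ge_1 by force
  have fin: "finite (generate G {a})"
    using assms generate_incl[of "{a}"] finite_subset by blast
  have "(\<Sum>x\<in>generate G {a}. 1 / totient (ord x)) =
     (\<Sum>d\<in>{d. d dvd ord a}. \<Sum>x\<in>{x\<in>generate G {a}. ord x = d}. 1 / totient (ord x))"
    using fin pos ord_dvd_ord_generator[OF assms(2)] by (intro sum.group[symmetric]) auto
  also have "\<dots> = (\<Sum>d\<in>{d. d dvd ord a}. 1)"
  proof (rule sum.cong[OF refl])
    fix d assume "d \<in> {d. d dvd ord a}"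
    then have "d dvd ord a" "totient d > 0" using pos by (auto intro: Nat.gr0I)
    then show "(\<Sum>x\<in>{x\<in>generate G {a}. ord x = d}. 1 / totient (ord x)) = (1::real)"
      using card_generate_ord_eq[OF assms, of d] by simp
  qed
  finally show ?thesis by simp
qed

end

section \<open>Coset products and the relation
  \<open>x \<otimes> a = a [^] k \<otimes> x\<close>\<close>

context group
begin

text \<open>If two products agree for exponents \<open>j < j'\<close>, cancelling puts
  \<open>x [^] (j' - j)\<close> into \<open>H\<close>. The cosets of \<open>H\<close> by these
  powers of \<open>x\<close> are therefore disjoint, which later bounds \<open>i\<close> by the
  index.\<close>

lemma inj_on_power_mult_subgroup:
  assumes H: "subgroup H G" and x: "x \<in> carrier G"
    and min: "\<And>j. 0 < j \<Longrightarrow> j < i \<Longrightarrow> x [^] j \<notin> H"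
  shows "inj_on (\<lambda>(j, h). x [^] j \<otimes> h) ({..<(i::nat)} \<times> H)"
proof -
  have *: "j \<ge> j'" if "j < i" "j' < i" "h \<in> H" "h' \<in> H" "x [^] j \<otimes> h = x [^] j' \<otimes> h'" for j j' h h'
  proof (rule ccontr)
    assume "\<not> j \<ge> j'"
    then have lt: "0 < j' - j" "j' - j < i" and j': "j' = j + (j' - j)" using that by auto
    have c: "h \<in> carrier G" "h' \<in> carrier G" using that subgroup.mem_carrier[OF H] by auto
    have "x [^] j \<otimes> h = x [^] j \<otimes> (x [^] (j' - j) \<otimes> h')"
      using that(5) j' x c by (metis m_assoc nat_pow_closed nat_pow_mult)
    then have "h = x [^] (j' - j) \<otimes> h'" using x c by simp
    then have "x [^] (j' - j) = h \<otimes> inv h'" using x c by (simp add: m_assoc)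
    then have "x [^] (j' - j) \<in> H" using that H by (simp add: subgroup.m_closed subgroup.m_inv_closed)
    with min[OF lt] show False by simp
  qed
  show ?thesis
  proof (clarsimp simp: inj_on_def)
    fix j h j' h' assume a: "j < i" "h \<in> H" "j' < i" "h' \<in> H" "x [^] j \<otimes> h = x [^] j' \<otimes> h'"
    then have "j = j'" using * by (metis le_antisym)
    moreover have "h \<in> carrier G" "h' \<in> carrier G" using a subgroup.mem_carrier[OF H] by auto
    ultimately show "j = j' \<and> h = h'" using a x by simp
  qed
qed

lemma mult_pow_commute:
  assumes "x \<in> carrier G" "a \<in> carrier G" "x \<otimes> a = a [^] (k::nat) \<otimes> x"
  shows "x \<otimes> a [^] (n::nat) = a [^] (k * n) \<otimes> x"
proof (induction n)
  case (Suc n)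
  have "x \<otimes> a [^] Suc n = (x \<otimes> a [^] n) \<otimes> a" using assms by (simp add: m_assoc)
  also have "\<dots> = a [^] (k * n) \<otimes> (x \<otimes> a)" using Suc assms(1,2) by (simp add: m_assoc)
  also have "\<dots> = a [^] (k * Suc n) \<otimes> x"
    using assms by (simp add: m_assoc[symmetric] nat_pow_mult add.commute)
  finally show ?case .
qed (use assms in simp)

text \<open>Collecting the factors \<open>x\<close> on the right multiplies the exponent of each
  passed power of \<open>a\<close> by \<open>k\<close>. Once a power of \<open>x\<close> lies in the
  group generated by \<open>a\<close>, a good choice of \<open>n\<close> yields elements of small
  order.\<close>

lemma pow_mult_square:
  assumes "x \<in> carrier G" "a \<in> carrier G" "x \<otimes> a = a [^] (k::nat) \<otimes> x"
  shows "(a [^] (n::nat) \<otimes> x) [^] (2::nat) = a [^] (n * (1 + k)) \<otimes> x [^] (2::nat)"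
proof -
  have "(a [^] n \<otimes> x) [^] (2::nat) = a [^] n \<otimes> (x \<otimes> a [^] n) \<otimes> x"
    using assms(1,2) by (simp add: numeral_2_eq_2 m_assoc)
  also have "\<dots> = a [^] n \<otimes> a [^] (k * n) \<otimes> (x \<otimes> x)"
    using assms(1,2) mult_pow_commute[OF assms] by (simp add: m_assoc)
  finally show ?thesis
    using assms(1,2) by (simp add: nat_pow_mult numeral_2_eq_2 algebra_simps)
qed

lemma pow_mult_cube:
  assumes "x \<in> carrier G" "a \<in> carrier G" "x \<otimes> a = a [^] (k::nat) \<otimes> x"
  shows "(a [^] (n::nat) \<otimes> x) [^] (3::nat) = a [^] (n * (1 + k + k * k)) \<otimes> x [^] (3::nat)"
proof -
  have "(a [^] n \<otimes> x) [^] (3::nat) = (a [^] n \<otimes> x) \<otimes> (a [^] n \<otimes> x) [^] (2::nat)"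
    using assms(1,2) nat_pow_Suc2[of "a [^] n \<otimes> x" 2] by (simp add: numeral_3_eq_3 numeral_2_eq_2)
  also have "\<dots> = a [^] n \<otimes> (x \<otimes> a [^] (n * (1 + k))) \<otimes> x [^] (2::nat)"
    using assms(1,2) pow_mult_square[OF assms] by (simp add: m_assoc)
  also have "\<dots> = a [^] n \<otimes> a [^] (k * (n * (1 + k))) \<otimes> (x \<otimes> x [^] (2::nat))"
    using assms(1,2) mult_pow_commute[OF assms] by (simp add: m_assoc)
  also have "x \<otimes> x [^] (2::nat) = x [^] (3::nat)"
    using assms(1) nat_pow_Suc2[of x 2] by (simp add: numeral_3_eq_3 numeral_2_eq_2)
  finally show ?thesis
    using assms(1,2) by (simp add: nat_pow_mult algebra_simps)
qed

text \<open>The difference is taken in the integers so that either exponent may be the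
  larger.\<close>

lemma pow_eq_pow_iff:
  assumes "x \<in> carrier G"
  shows "x [^] (k::nat) = x [^] (l::nat) \<longleftrightarrow> int (ord x) dvd int k - int l"
  using int_pow_eq[OF assms, of "int k" "int l"] by (simp add: int_pow_int dvd_diff_commute)

lemma int_pow_mod_ord:
  assumes "x \<in> carrier G"
  shows "x [^] (k mod int (ord x)) = x [^] k"
  using int_pow_eq[OF assms, of "k mod int (ord x)" k] dvd_minus_mod by blast

lemma ord_gt_1_iff:
  assumes "finite (carrier G)" "x \<in> carrier G"
  shows "ord x > 1 \<longleftrightarrow> x \<noteq> \<one>"
  using ord_eq_1[OF assms(2)] ord_ge_1[OF assms] by linarith

end

section \<open>A cyclic subgroup of maximal order\<close>

text \<open>Every finite group has an element of maximal order, so each one admits an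
  interpretation.\<close>

locale max_cyclic = group G for G (structure) +
  fixes a
  assumes fin: "finite (carrier G)"
    and a_closed [simp]: "a \<in> carrier G"
    and ord_le: "x \<in> carrier G \<Longrightarrow> ord x \<le> ord a"
begin

abbreviation M where "M \<equiv> generate G {a}"
abbreviation m where "m \<equiv> ord a"

lemma M_subgroup: "subgroup M G" by (rule generate_is_subgroup) simp

lemma M_subset: "M \<subseteq> carrier G" using M_subgroup subgroup.subset by blast

lemma finite_M: "finite M" using M_subset fin finite_subset by blast

lemma card_M: "card M = m" using generate_pow_card[of a] by simp

lemma m_pos: "m > 0" using ord_ge_1[of a] fin by force

lemma M_eq: "M = range (\<lambda>k::nat. a [^] k)"
  using generate_pow_on_finite_carrier[OF fin a_closed] by (simp add: full_SetCompr_eq)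

text \<open>Here \<open>i\<close> is the least positive exponent with \<open>x [^] i\<close> in
  \<open>M\<close>, and \<open>s\<close> is the order of that power. It divides \<open>m\<close>,
  and \<open>s = m\<close> would give \<open>ord x > m\<close>. The cosets of \<open>M\<close> by
  \<open>x [^] j\<close> with \<open>j < i\<close> are disjoint, hence
  \<open>i * m \<le> order G\<close>; equality means that they cover \<open>G\<close>.\<close>

lemma outsideE:
  assumes "x \<in> carrier G - M"
  obtains i s where "1 < i" "x [^] i \<in> M" "ord x = i * s" "s dvd m" "s < m" "i * m \<le> order G"
    "ord (x [^] i) = s"
    "i * m = order G \<Longrightarrow> carrier G = (\<lambda>(j, h). x [^] j \<otimes> h) ` ({..<i} \<times> M)"
proof -
  have x: "x \<in> carrier G" "x \<notin> M" using assms by auto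
  have ox: "ord x > 0" using ord_ge_1[of x] fin x by force
  define i :: nat where "i = (LEAST i. 0 < i \<and> x [^] i \<in> M)"
  have "x [^] ord x \<in> M" using x generate.one[of G] by simp
  then have i: "0 < i" "x [^] i \<in> M"
    unfolding i_def using LeastI[of "\<lambda>i. 0 < i \<and> x [^] i \<in> M" "ord x"] ox by auto
  have min: "x [^] j \<notin> M" if "0 < j" "j < i" for j
    using not_less_Least[of j "\<lambda>i. 0 < i \<and> x [^] i \<in> M"] that by (simp add: i_def)
  have "i \<noteq> 1" using i x by auto
  with i have i1: "1 < i" by simp
  have "i dvd ord x"
  proof (rule ccontr)
    assume "\<not> i dvd ord x"
    then have r: "0 < ord x mod i" "ord x mod i < i" using i by (auto simp: dvd_eq_mod_eq_0)
    \<comment> \<open>Division with remainder: a nonzero remainder would be a smaller positive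
      exponent that leads into \<open>M\<close>.\<close>
    have "\<one> = x [^] (i * (ord x div i) + ord x mod i)" using x by simp
    also have "\<dots> = (x [^] i) [^] (ord x div i) \<otimes> x [^] (ord x mod i)"
      using x by (simp only: nat_pow_mult[symmetric] nat_pow_pow)
    finally have "x [^] (ord x mod i) = inv ((x [^] i) [^] (ord x div i))"
      using x by (metis inv_equality inv_inv nat_pow_closed)
    moreover have "(x [^] i) [^] (ord x div i) \<in> M"
      using i M_subgroup by (metis a_closed empty_subsetI generate_is_subgroup insert_subset nat_pow_consistent subgroup_int_pow_closed int_pow_int)
    ultimately have "x [^] (ord x mod i) \<in> M" using M_subgroup by (simp add: subgroup.m_inv_closed)
    with min[OF r] show False by simp
  qed
  then obtain s where s: "ord x = i * s" by blast
  have os: "ord (x [^] i) = s" using ord_pow[OF x(1), of i] i s by simp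
  have sdvd: "s dvd m" using ord_dvd_ord_generator[OF a_closed i(2)] os by simp
  have "s \<noteq> m" using s ord_le[OF x(1)] i1 m_pos by auto
  with sdvd have sm: "s < m" using m_pos dvd_imp_le by (metis le_neq_implies_less)
  have inj: "inj_on (\<lambda>(j, h). x [^] j \<otimes> h) ({..<i} \<times> M)"
    using inj_on_power_mult_subgroup[OF M_subgroup x(1)] min by blast
  then have c: "card ((\<lambda>(j, h). x [^] j \<otimes> h) ` ({..<i} \<times> M)) = i * m"
    by (simp add: card_image card_cartesian_product card_M)
  have sub: "(\<lambda>(j, h). x [^] j \<otimes> h) ` ({..<i} \<times> M) \<subseteq> carrier G" using x M_subset by auto
  show ?thesis
  proof (rule that[OF i1 i(2) s sdvd sm _ os])
    show "i * m \<le> order G" using c card_mono[OF fin sub] by (simp add: order_def)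
    show "carrier G = (\<lambda>(j, h). x [^] j \<otimes> h) ` ({..<i} \<times> M)" if "i * m = order G"
      using card_subset_eq[OF fin sub] c that by (simp add: order_def)
  qed
qed

text \<open>If \<open>c = x \<otimes> a \<otimes> inv x\<close> were outside \<open>M\<close>, then
  by \<open>full\<close> the cosets of \<open>M\<close> by powers of \<open>c\<close> would fill
  \<open>G\<close>, so \<open>x = c [^] j \<otimes> a [^] n\<close>. Comparing
  \<open>c \<otimes> x\<close> with \<open>x \<otimes> a\<close> then cancels to
  \<open>c = a\<close>, which lies in \<open>M\<close>. The condition \<open>full\<close> holds when
  the index and the orders leave a single possible \<open>i\<close>.\<close>

lemma conjugate_generator:
  assumes full: "\<And>c i s. \<lbrakk>c \<in> carrier G - M; 1 < i; ord c = i * s; s dvd m; i * m \<le> order G\<rbrakk>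
      \<Longrightarrow> i * m = order G"
    and x: "x \<in> carrier G"
  obtains k :: nat where "x \<otimes> a = a [^] k \<otimes> x"
proof -
  define c where "c = x \<otimes> a \<otimes> inv x"
  have c: "c \<in> carrier G" using x by (simp add: c_def)
  have cx: "c \<otimes> x = x \<otimes> a" using x by (simp add: c_def m_assoc)
  have "c \<in> M"
  proof (rule ccontr)
    assume "c \<notin> M"
    then have "c \<in> carrier G - M" using c by simp
    then obtain i where "carrier G = (\<lambda>(j, h). c [^] j \<otimes> h) ` ({..<(i::nat)} \<times> M)"
      by (rule outsideE) (use full \<open>c \<in> carrier G - M\<close> in blast)
    then obtain j n :: nat where xj: "x = c [^] j \<otimes> a [^] n"
      using x by (auto simp: M_eq)
    have "c [^] j \<otimes> (c \<otimes> a [^] n) = c \<otimes> x"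
      using c xj nat_pow_Suc2[of c j] by (simp add: m_assoc[symmetric])
    also have "\<dots> = c [^] j \<otimes> (a \<otimes> a [^] n)"
      using c xj cx nat_pow_Suc2[of a n] by (simp add: m_assoc)
    finally have "c = a" using c by simp
    then show False using \<open>c \<notin> M\<close> generate.incl[of a "{a}" G] by simp
  qed
  then obtain k :: nat where "c = a [^] k" by (auto simp: M_eq)
  with cx show ?thesis using that by metis
qed

lemma power_mult_outside:
  assumes "x \<in> carrier G - M"
  shows "a [^] (n::nat) \<otimes> x \<in> carrier G - M"
proof -
  have x: "x \<in> carrier G" "x \<notin> M" using assms by auto
  have "x \<in> M" if "a [^] n \<otimes> x \<in> M"
  proof -
    have "a [^] n \<in> M" by (simp add: M_eq)
    then have "inv (a [^] n) \<in> M" by (rule subgroup.m_inv_closed[OF M_subgroup])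
    then have "inv (a [^] n) \<otimes> (a [^] n \<otimes> x) \<in> M" using that subgroup.m_closed[OF M_subgroup] by simp
    then show "x \<in> M" using x by (simp add: m_assoc[symmetric])
  qed
  with x show ?thesis by auto
qed

text \<open>\<open>x\<close> commutes with its own power \<open>a [^] l\<close>, whereas moving
  \<open>x\<close> past it changes the exponent to \<open>k * l\<close>.\<close>

lemma commuting_power:
  assumes x: "x \<in> carrier G" and k: "x \<otimes> a = a [^] (k::nat) \<otimes> x"
    and l: "x [^] (i::nat) = a [^] (l::nat)"
  shows "int m dvd int (k * l) - int l"
proof -
  have "a [^] (k * l) \<otimes> x = x \<otimes> x [^] i"
    using mult_pow_commute[OF x a_closed k] l by simp
  also have "\<dots> = a [^] l \<otimes> x" using x nat_pow_Suc2[of x i] by (simp add: l[symmetric])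
  finally have "a [^] (k * l) = a [^] l" using x by simp
  then show ?thesis by (simp add: pow_eq_pow_iff)
qed

text \<open>With \<open>x [^] 2 = a [^] l\<close>, the orders give \<open>l\<close> congruent to 2
  modulo 4, and \<open>commuting_power\<close> gives \<open>k\<close> congruent to 1 modulo 4. So 4
  divides \<open>1 + k + l\<close>, the exponent of the square of \<open>a \<otimes> x\<close>; this
  element is outside \<open>M\<close> but has order dividing 4.\<close>

lemma not_all_outside_order_8:
  assumes "m = 8" "order G = 16" "x \<in> carrier G - M" and all: "\<And>y. y \<in> carrier G - M \<Longrightarrow> ord y = 8"
  shows False
proof -
  have x: "x \<in> carrier G" "x \<notin> M" using assms by auto
  obtain i s where i: "1 < i" "i * m \<le> order G" "x [^] i \<in> M" "ord x = i * s" "ord (x [^] i) = s"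
    using outsideE[OF assms(3)] by metis
  have "i = 2" using i assms by simp
  with i all[OF assms(3)] have x2: "x [^] (2::nat) \<in> M" "ord (x [^] (2::nat)) = 4" by auto
  obtain k where k: "x \<otimes> a = a [^] (k::nat) \<otimes> x"
    by (rule conjugate_generator[OF _ x(1)]) (use assms in auto)
  obtain l :: nat where l: "x [^] (2::nat) = a [^] l" using x2 by (auto simp: M_eq)
  have "l \<noteq> 0" using l x2 by (intro notI) simp
  then have "8 div gcd 8 l = 4"
    using l x2 ord_pow_gen[OF a_closed, of l] assms(1) by simp
  moreover have "gcd 8 l * (8 div gcd 8 l) = 8" by (rule dvd_mult_div_cancel) simp
  ultimately have gcd: "gcd 8 l = 2" by simp
  have kl: "8 dvd int (k * l) - int l" using commuting_power[OF x(1) k l] assms by simp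
  obtain l' where l': "l = 2 * l'" using gcd by (metis dvd_def gcd_dvd2)
  have "\<not> 4 dvd l" using gcd gcd_greatest[of 4 8 l] by auto
  then have "odd l'" unfolding l' by presburger
  \<comment> \<open>The congruence modulo 8 is halved; the odd \<open>l'\<close> then cancels modulo
    4.\<close>
  have "int (k * l) - int l = 2 * (int l' * (int k - 1))" by (simp add: l' algebra_simps)
  with kl have "4 dvd int l' * (int k - 1)" by presburger
  moreover have "coprime 4 (int l')"
    using \<open>odd l'\<close> coprime_power_left_iff[of 2 2 "int l'"] by simp
  ultimately have "4 dvd int k - 1" using coprime_dvd_mult_right_iff by blast
  with \<open>odd l'\<close> have "4 dvd 1 + k + l" unfolding l' by presburger
  then have "8 dvd (1 + k + l) * 2" by presburger
  have "(a [^] (1::nat) \<otimes> x) [^] (2::nat) = a [^] (1 + k + l)"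
    using pow_mult_square[OF x(1) a_closed k, of 1] by (simp only: l nat_pow_mult[OF a_closed] mult_1)
  then have "(a [^] (1::nat) \<otimes> x) [^] (2 * 2::nat) = a [^] ((1 + k + l) * 2)"
    using x by (metis a_closed m_closed nat_pow_closed nat_pow_pow)
  also have "\<dots> = \<one>" using \<open>8 dvd _ * 2\<close> by (simp only: assms(1) pow_eq_id[OF a_closed])
  finally have "ord (a [^] (1::nat) \<otimes> x) dvd 4" using x pow_eq_id by (simp del: nat_pow_eone)
  then show False using all[OF power_mult_outside[OF assms(3), of 1]] by simp
qed

text \<open>The cubic analogue: \<open>x [^] 3 = a [^] l\<close> with 3 but not 9 dividing
  \<open>l\<close> forces \<open>k\<close> to be 1 modulo 3, and a suitable
  \<open>a [^] n \<otimes> x\<close> has trivial cube.\<close>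

lemma not_all_outside_order_9:
  assumes "m = 9" "order G = 27" "x \<in> carrier G - M" and all: "\<And>y. y \<in> carrier G - M \<Longrightarrow> ord y = 9"
  shows False
proof -
  have x: "x \<in> carrier G" "x \<notin> M" using assms by auto
  \<comment> \<open>The index allows 2 and 3, but 2 does not divide the order 9. This also supplies
    the condition of \<open>conjugate_generator\<close>.\<close>
  have three: "i = 3" if "c \<in> carrier G - M" "1 < i" "ord c = i * s" "i * m \<le> order G" for c i s
  proof -
    have "i \<le> 3" using that assms by simp
    moreover have "i * s = 9" using that all by simp
    then have "i \<noteq> 2" by (intro notI, hypsubst) presburger
    ultimately show ?thesis using that by simp
  qed
  obtain i s where i: "1 < i" "i * m \<le> order G" "x [^] i \<in> M" "ord x = i * s" "ord (x [^] i) = s"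
    using outsideE[OF assms(3)] by metis
  have "i = 3" using three i assms by metis
  with i all[OF assms(3)] have x3: "x [^] (3::nat) \<in> M" "ord (x [^] (3::nat)) = 3" by auto
  obtain k where k: "x \<otimes> a = a [^] (k::nat) \<otimes> x"
  proof (rule conjugate_generator[OF _ x(1)])
    show "i * m = order G" if "c \<in> carrier G - M" "1 < i" "ord c = i * s" "i * m \<le> order G" for c i s
      using three[OF that] assms by simp
  qed 
  obtain l :: nat where l: "x [^] (3::nat) = a [^] l" using x3 by (auto simp: M_eq)
  have "l \<noteq> 0" using l x3 by (intro notI) simp
  then have "9 div gcd 9 l = 3"
    using l x3 ord_pow_gen[OF a_closed, of l] assms(1) by simp
  moreover have "gcd 9 l * (9 div gcd 9 l) = 9" by (rule dvd_mult_div_cancel) simp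
  ultimately have gcd: "gcd 9 l = 3" by simp
  have kl: "9 dvd int (k * l) - int l" using commuting_power[OF x(1) k l] assms by simp
  obtain l' where l': "l = 3 * l'" using gcd by (metis dvd_def gcd_dvd2)
  have "\<not> 9 dvd l" using gcd gcd_greatest[of 9 9 l] by auto
  then have "\<not> 3 dvd int l'" unfolding l' by presburger
  then have "coprime 3 (int l')" using prime_imp_coprime[of 3 "int l'"] by simp
  have "int (k * l) - int l = 3 * (int l' * (int k - 1))" by (simp add: l' algebra_simps)
  with kl have "3 dvd int l' * (int k - 1)" by presburger
  then have "3 dvd int k - 1" using \<open>coprime 3 (int l')\<close> coprime_dvd_mult_right_iff by blast
  then obtain j where j: "int k = 1 + 3 * j" by (auto elim!: dvdE simp: algebra_simps)
  \<comment> \<open>\<open>1 + k + k\<^sup>2 \<equiv> 3\<close> modulo 9, so \<open>n = 2 l'\<close> turns the exponent into \<open>9 l' \<equiv> 0\<close>.\<close>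
  have "int (2 * l' * (1 + k + k * k) + l) = 9 * (int l' * (1 + 2 * j + 2 * j * j))"
    by (simp add: j l' algebra_simps)
  then have "9 dvd 2 * l' * (1 + k + k * k) + l" by (metis dvd_triv_left int_dvd_int_iff of_nat_numeral)
  moreover have "(a [^] (2 * l') \<otimes> x) [^] (3::nat) = a [^] (2 * l' * (1 + k + k * k) + l)"
    using pow_mult_cube[OF x(1) a_closed k, of "2 * l'"] l by (simp add: nat_pow_mult)
  ultimately have "(a [^] (2 * l') \<otimes> x) [^] (3::nat) = \<one>" using assms(1) pow_eq_id by simp
  then have "ord (a [^] (2 * l') \<otimes> x) dvd 3" using x pow_eq_id by simp
  then show False using all[OF power_mult_outside[OF assms(3), of "2 * l'"]] by simp
qed

lemma order_eq: "order G = (order G div m) * m"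
  using lagrange[OF M_subgroup] card_M by (metis dvd_div_mult_self dvd_triv_right)

lemma card_outside: "card (carrier G - M) = (order G div m - 1) * m"
  using card_Diff_subset[OF finite_M M_subset] order_eq card_M
  by (simp add: order_def diff_mult_distrib)

lemma card_cyclic_subgroups_outside:
  "real (card (cyclic_subgroups G)) =
     card {d. d dvd m} + (\<Sum>x\<in>carrier G - M. 1 / totient (ord x))"
  using card_cyclic_subgroups[OF fin] sum_generate_inverse_totient[OF fin a_closed]
    sum.subset_diff[OF M_subset fin, of "\<lambda>x. 1 / real (totient (ord x))"] by simp

end

section \<open>Index bounds and the case distinction\<close>

context max_cyclic
begin

lemma outside_totient_bounds:
  assumes "x \<in> carrier G - M"
  shows "1 < ord x" "0 < totient (ord x)" "totient (ord x) \<le> m - 1"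
proof -
  have "x \<noteq> \<one>" using assms generate.one[of G] by auto
  then show "1 < ord x" using assms ord_gt_1_iff[OF fin] by auto
  moreover have "ord x \<le> m" using assms ord_le by simp
  ultimately show "0 < totient (ord x)" "totient (ord x) \<le> m - 1"
    using totient_less[of "ord x"] by auto
qed

text \<open>The reciprocals over the complement of \<open>M\<close> add up to \<open>k\<close>, and
  each is at least \<open>1 / B\<close>. When the total is as small as this permits, every one of
  them equals \<open>1 / B\<close>.\<close>

lemma card_outside_le:
  assumes "card (cyclic_subgroups G) = card {d. d dvd m} + k"
    and "B > 0" and "\<And>x. x \<in> carrier G - M \<Longrightarrow> totient (ord x) \<le> B"
  shows "(order G div m - 1) * m \<le> B * k"
    and "(order G div m - 1) * m = B * k \<Longrightarrow> x \<in> carrier G - M \<Longrightarrow> totient (ord x) = B"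
proof -
  let ?O = "carrier G - M"
  have S: "(\<Sum>x\<in>?O. 1 / real (totient (ord x))) = real k"
    using card_cyclic_subgroups_outside assms(1) by simp
  have c: "(\<Sum>x\<in>?O. 1 / real B) = real ((order G div m - 1) * m) / real B"
    using card_outside by simp
  have le: "1 / real B \<le> 1 / real (totient (ord x))" if "x \<in> ?O" for x
    using that assms(3) outside_totient_bounds(2) by (simp add: frac_le)
  have "real ((order G div m - 1) * m) / real B \<le> real k"
    unfolding c[symmetric] S[symmetric] by (rule sum_mono) (rule le)
  then have "real ((order G div m - 1) * m) \<le> real (B * k)"
    using assms(2) by (simp add: divide_le_eq mult.commute)
  then show "(order G div m - 1) * m \<le> B * k" by linarith
  assume eq: "(order G div m - 1) * m = B * k" and x: "x \<in> ?O"
  have "(\<Sum>x\<in>?O. 1 / real B) = (\<Sum>x\<in>?O. 1 / real (totient (ord x)))"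
    unfolding c S eq using assms(2) by simp
  then have "1 / real B = 1 / real (totient (ord x))"
    using le x fin by (intro sum_mono_inv[of "\<lambda>_. 1 / real B" ?O "\<lambda>x. 1 / real (totient (ord x))"]) auto
  then show "totient (ord x) = B" by simp
qed

lemma card_outside_eq:
  assumes "card (cyclic_subgroups G) = card {d. d dvd m} + k"
    and "\<And>x. x \<in> carrier G - M \<Longrightarrow> totient (ord x) = B"
  shows "(order G div m - 1) * m = B * k"
proof (cases "carrier G - M = {}")
  \<comment> \<open>The sum is empty, so \<open>k = 0\<close> and both sides vanish for any
    \<open>B\<close>.\<close>
  case True
  then have "card (carrier G - M) = 0" "(\<Sum>x\<in>carrier G - M. 1 / real (totient (ord x))) = 0"
    by (simp_all only: card.empty sum.empty)
  then show ?thesis using card_cyclic_subgroups_outside assms(1) card_outside by simp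
next
  case False
  then have "B > 0" using outside_totient_bounds(2) assms(2) by fastforce
  have "(\<Sum>x\<in>carrier G - M. 1 / real (totient (ord x))) = (\<Sum>x\<in>carrier G - M. 1 / real B)"
    using assms(2) by (intro sum.cong) auto
  then have "real k = real ((order G div m - 1) * m) / real B"
    using card_cyclic_subgroups_outside assms(1) card_outside by simp
  then have "real ((order G div m - 1) * m) = real (B * k)"
    using \<open>B > 0\<close> by (simp add: field_simps)
  then show ?thesis by linarith
qed

lemma outside_index_2:
  assumes "x \<in> carrier G - M" "order G = 2 * m"
  obtains s where "ord x = 2 * s" "s dvd m" "s < m" "totient (ord x) \<le> s" "s > 0"
proof -
  obtain i s where i: "1 < i" "ord x = i * s" "s dvd m" "s < m" "i * m \<le> order G"
    using outsideE[OF assms(1)] by metis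
  have "i = 2" using i assms(2) m_pos by simp
  moreover have "s > 0" using i outside_totient_bounds(1)[OF assms(1)] by (cases s) auto
  ultimately show ?thesis using that[of s] i totient_prime_mult_le[of 2 s] two_is_prime_nat by simp
qed

text \<open>Now \<open>i\<close> may be 2 or 3; the bounds \<open>s\<close> and \<open>2 * s\<close>
  are merged into the weaker one.\<close>

lemma outside_index_3:
  assumes "x \<in> carrier G - M" "order G = 3 * m"
  obtains s where "ord x = 2 * s \<or> ord x = 3 * s" "s dvd m" "s < m" "totient (ord x) \<le> 2 * s" "s > 0"
proof -
  obtain i s where i: "1 < i" "ord x = i * s" "s dvd m" "s < m" "i * m \<le> order G"
    using outsideE[OF assms(1)] by metis
  have "i = 2 \<or> i = 3" using i assms(2) m_pos by auto
  moreover have "s > 0" using i outside_totient_bounds(1)[OF assms(1)] by (cases s) auto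
  moreover have "Factorial_Ring.prime (3::nat)" by simp
  ultimately show ?thesis using that[of s] i totient_prime_mult_le[of 2 s] totient_prime_mult_le[of 3 s]
    two_is_prime_nat by auto
qed

text \<open>Since totients outside \<open>M\<close> are below \<open>m\<close>, the count gives
  \<open>t - 1 < k\<close>. With \<open>t \<ge> 2\<close> and \<open>m > 1\<close> this leaves
  \<open>d\<close> from 2 to 4 and a few values of \<open>t\<close>; sharper totient bounds then
  exclude all but \<open>m = 4\<close>, \<open>t = 2\<close>.\<close>

lemma noncyclic_card_6:
  assumes six: "card (cyclic_subgroups G) = 6" and ne: "M \<noteq> carrier G"
  shows "m = 4 \<and> order G = 8"
proof -
  define t where "t = order G div m"
  define d where "d = card {d. d dvd m}"
  define k where "k = 6 - d"
  have order: "order G = t * m" unfolding t_def by (rule order_eq)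
  obtain x where x: "x \<in> carrier G - M" using ne M_subset by blast
  have m1: "m > 1" using outside_totient_bounds[OF x] by linarith
  \<comment> \<open>Ensures that the subtraction defining \<open>k\<close> is not truncated.\<close>
  have "d \<le> 6"
  proof -
    have "real 6 = real d + (\<Sum>x\<in>carrier G - M. 1 / totient (ord x))"
      using card_cyclic_subgroups_outside six by (simp add: d_def)
    moreover have "(\<Sum>x\<in>carrier G - M. 1 / real (totient (ord x))) \<ge> 0" by (intro sum_nonneg) auto
    ultimately show ?thesis by linarith
  qed
  then have sum: "card (cyclic_subgroups G) = card {d. d dvd m} + k" using six by (simp add: d_def k_def)
  note le = card_outside_le[OF sum, folded t_def] and eq = card_outside_eq[OF sum, folded t_def]
  have t2: "t \<ge> 2"
  proof -
    have "card (carrier G - M) > 0" using x fin by (simp add: card_gt_0_iff) blast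
    then show ?thesis using card_outside by (simp add: t_def)
  qed
  have "(t - 1) * m \<le> (m - 1) * k" using le(1)[of "m - 1"] outside_totient_bounds(3) m1 by simp
  moreover have "k > 0" using calculation t2 m1 by (intro Nat.gr0I) auto
  moreover have "(m - 1) * k < m * k"
    using m1 calculation(2) by (intro mult_strict_right_mono) auto
  ultimately have "(t - 1) * m < k * m" by (metis le_less_trans mult.commute)
  then have tk: "t - 1 < k" by simp
  have "d \<noteq> 0" using m_pos by (auto simp: d_def)
  moreover have "d \<noteq> 1" using card_divisors_eq_1_iff[of m] m1 by (simp add: d_def)
  ultimately consider "d = 2" "k = 4" | "d = 3" "k = 3" | "d = 4" "k = 2"
    using tk t2 unfolding k_def by linarith
  then show ?thesis
  proof cases
    case 1
    have p: "Factorial_Ring.prime m" using card_divisors_eq_2D 1 by (simp add: d_def)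
    \<comment> \<open>As \<open>m\<close> is prime, \<open>s = 1\<close>, so the order of
      \<open>y\<close> is \<open>i\<close> itself and bounded by the index.\<close>
    have ordx: "ord y \<le> t" "ord y > 1" if y: "y \<in> carrier G - M" for y
    proof -
      obtain i s where i: "1 < i" "ord y = i * s" "s dvd m" "s < m" "i * m \<le> order G"
        using outsideE[OF y] by metis
      then have "s = 1" using p by (auto simp: prime_nat_iff)
      then show "ord y \<le> t" using i order m1 by simp
      show "ord y > 1" using outside_totient_bounds y by blast
    qed
    consider "t = 2" | "t = 3" | "t = 4" using t2 tk 1 by linarith
    then show ?thesis
    proof cases
      assume t: "t = 2"
      have "totient (ord y) = 1" if "y \<in> carrier G - M" for y
      proof -
        have "ord y = 2" using ordx[OF that] t by linarith
        then show ?thesis by simp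
      qed
      then have "m = 4" using eq[of 1] t 1 by simp
      then show ?thesis using p by simp
    next
      assume t: "t = 3"
      have tot: "totient (ord y) = (if ord y = 2 then 1 else 2)" if "y \<in> carrier G - M" for y
      proof -
        have "ord y = 2 \<or> ord y = 3" using ordx[OF that] t by linarith
        then show ?thesis by (auto simp: totient_prime)
      qed
      have "2 * m \<le> 2 * 4" using le(1)[of 2] tot t 1 by simp
      moreover have "m \<noteq> 4" using p by auto
      ultimately have "m = 2 \<or> m = 3" using m1 by linarith
      then show ?thesis
      proof
        assume m: "m = 2"
        \<comment> \<open>A subgroup of order 3 contains an element of order 3, although no order
          exceeds 2.\<close>
        then have "order G = 3 ^ 1 * 2" using order t by simp
        then obtain H where H: "subgroup H G" "card H = 3"
          using sylow_thm[of 3 G 1 2] is_group fin by auto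
        have "\<exists>h\<in>H. h \<noteq> \<one>"
        proof (rule ccontr)
          assume "\<not> ?thesis"
          then have "H \<subseteq> {\<one>}" by blast
          then show False using H card_mono[of "{\<one>}" H] by simp
        qed
        then obtain h where h: "h \<in> H" "h \<noteq> \<one>" by blast
        have hG: "h \<in> carrier G" using subgroup.mem_carrier[OF H(1) h(1)] .
        have "ord h = 2" using ord_le[OF hG] m ord_gt_1_iff[OF fin hG] h by linarith
        interpret H: group "G\<lparr>carrier := H\<rparr>" by (rule subgroup.subgroup_is_group[OF H(1) is_group])
        have "h [^]\<^bsub>G\<lparr>carrier := H\<rparr>\<^esub> order (G\<lparr>carrier := H\<rparr>) = \<one>"
          using H.pow_order_eq_1[of h] h by simp
        then have "h [^] (3::nat) = \<one>" using H by (simp add: order_def nat_pow_consistent[symmetric])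
        then have "ord h dvd 3" using hG pow_eq_id by simp
        then show ?thesis using \<open>ord h = 2\<close> by simp
      next
        assume m: "m = 3"
        \<comment> \<open>Order 2 is impossible in a group of order 9; the count would then demand
          \<open>2 * 3 = 2 * 4\<close>.\<close>
        have "ord y = 3" if y: "y \<in> carrier G - M" for y
        proof -
          have "ord y dvd 9" using ord_dvd_group_order[of y] order t m y by simp
          then have "ord y \<noteq> 2" by auto
          then show ?thesis using ordx[OF y] t by linarith
        qed
        then have "totient (ord y) = 2" if "y \<in> carrier G - M" for y using tot that by simp
        then show ?thesis using eq[of 2] t m 1 by simp
      qed
    next
      assume t: "t = 4"
      have tot: "totient (ord y) \<le> 2" if "y \<in> carrier G - M" for y
      proof -
        have "ord y = 2 \<or> ord y = 3 \<or> ord y = 4" using ordx[OF that] t by linarith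
        then show ?thesis by (auto simp: totient_prime)
      qed
      have "3 * m \<le> 2 * 4" using le(1)[of 2] tot t 1 by simp
      then have m: "m = 2" using m1 by linarith
      have "totient (ord y) = 1" if "y \<in> carrier G - M" for y
      proof -
        have "ord y = 2" using ordx(2)[OF that] ord_le[of y] that m by simp
        then show ?thesis by simp
      qed
      \<comment> \<open>The count would demand \<open>3 * 2 = 4\<close>.\<close>
      then show ?thesis using eq[of 1] t m 1 by simp
    qed
  next
    case 2
    obtain p where p: "Factorial_Ring.prime p" "m = p ^ 2" using card_divisors_eq_3D 2 by (auto simp: d_def)
    have p2: "p \<ge> 2" using p prime_ge_2_nat by blast
    have sp: "s = 1 \<or> s = p" if s: "s dvd m" "s < m" for s
    proof -
      obtain i where i: "i \<le> 2" "s = p ^ i" using s p by (auto simp: divides_primepow_nat)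
      moreover have "i \<noteq> 2" using i s p by auto
      ultimately have "i = 0 \<or> i = 1" by linarith
      then show ?thesis using i by auto
    qed
    consider "t = 2" | "t = 3" using t2 tk 2 by linarith
    then show ?thesis
    proof cases
      assume t: "t = 2"
      have ord: "ord y = 2 \<or> ord y = 2 * p" "totient (ord y) \<le> p" if y: "y \<in> carrier G - M" for y
      proof -
        obtain s where "ord y = 2 * s" "s dvd m" "s < m" "totient (ord y) \<le> s" "s > 0"
          using outside_index_2[OF y] order t by blast
        then show "ord y = 2 \<or> ord y = 2 * p" "totient (ord y) \<le> p" using sp[of s] p2 by auto
      qed
      \<comment> \<open>This reads \<open>p * p \<le> p * 3\<close>. For \<open>p = 3\<close> the
        orders 2 and 6 have totient at most 2, giving \<open>9 \<le> 6\<close>; \<open>p = 2\<close>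
        is the surviving case.\<close>
      have "m \<le> p * 3" using le(1)[of p] ord p2 t 2 by simp
      then have "p \<le> 3" using p(2) p2 by (simp add: power2_eq_square)
      moreover have "p \<noteq> 3"
      proof
        assume p3: "p = 3"
        have "totient (ord y) \<le> 2" if "y \<in> carrier G - M" for y
          using ord(1)[OF that] p3 by auto
        then show False using le(1)[of 2] t 2 p p3 by simp
      qed
      ultimately have "p = 2" using p2 by linarith
      then show ?thesis using order t p by simp
    next
      assume t: "t = 3"
      have tot: "totient (ord y) \<le> 2 * p" if y: "y \<in> carrier G - M" for y
      proof -
        obtain s where "s dvd m" "s < m" "totient (ord y) \<le> 2 * s"
          using outside_index_3[OF y] order t by blast
        then show ?thesis using sp[of s] p2 by auto
      qed
      have "2 * m \<le> 2 * p * 3" using le(1)[of "2 * p"] tot p2 t 2 by simp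
      then have "p \<le> 3" using p(2) p2 by (simp add: power2_eq_square)
      then have "p = 2 \<or> p = 3" using p2 by linarith
      then show ?thesis
      proof
        assume p2: "p = 2"
        have "totient (ord y) \<le> 2" if y: "y \<in> carrier G - M" for y
        proof -
          have "ord y = 2 \<or> ord y = 3 \<or> ord y = 4"
            using outside_totient_bounds(1)[OF y] ord_le[of y] y p p2 by auto
          then show ?thesis by (auto simp: totient_prime)
        qed
        then show ?thesis using le(1)[of 2] t 2 p p2 by simp
      next
        assume p3: "p = 3"
        have "ord y = 9" if y: "y \<in> carrier G - M" for y
        proof -
          \<comment> \<open>The bound is attained, since \<open>2 * 9 = 6 * 3\<close>; hence every
            totient is exactly 6, and among the powers of 3 up to 9 only 9 fits.\<close>
          have t6: "totient (ord y) = 6" using le(2)[of 6 y] tot y t 2 p p3 by simp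
          have "ord y dvd 3 ^ 3" using ord_dvd_group_order[of y] order t p p3 y by simp
          then obtain i where i: "i \<le> 3" "ord y = 3 ^ i"
            using divides_primepow_nat[of 3 "ord y" 3] by auto
          have "i \<noteq> 0" using t6 i by (intro notI) simp
          moreover have "i \<noteq> 1" using t6 i by (intro notI) (simp add: totient_prime)
          moreover have "i \<noteq> 3" using i ord_le[of y] y p p3 by (intro notI) simp
          ultimately have "i = 2" using i by linarith
          then show ?thesis using i by simp
        qed
        then show ?thesis using not_all_outside_order_9[OF _ _ x] order t p p3 by simp
      qed
    qed
  next
    case 3
    have t: "t = 2" using t2 tk 3 by linarith
    have half: "2 * s \<le> m" if s: "s dvd m" "s < m" for s
    proof -
      obtain c where c: "m = s * c" using s by blast
      then have "c \<noteq> 0" "c \<noteq> 1" using s by auto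
      then have "2 \<le> c" by linarith
      then show ?thesis using c by simp
    qed
    have tot: "totient (ord y) \<le> m div 2" if y: "y \<in> carrier G - M" for y
    proof -
      obtain s where "s dvd m" "s < m" "totient (ord y) \<le> s"
        using outside_index_2[OF y] order t by blast
      then show ?thesis using half[of s] by linarith
    qed
    have "m div 2 > 0" using m1 by simp
    \<comment> \<open>As \<open>div\<close> rounds down, this forces \<open>m\<close> to be even and
      the bound to be attained.\<close>
    from le(1)[OF this tot] have "m \<le> m div 2 * 2" using t 3 by simp
    then have ev: "m = m div 2 * 2" by linarith
    have oy: "ord y = m" "totient (ord y) = m div 2" if y: "y \<in> carrier G - M" for y
    proof -
      show e: "totient (ord y) = m div 2" using le(2)[OF \<open>m div 2 > 0\<close> tot _ y] ev t 3 by simp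
      obtain s where "ord y = 2 * s" "s dvd m" "s < m" "totient (ord y) \<le> s"
        using outside_index_2[OF y] order t by blast
      then show "ord y = m" using half[of s] e ev by linarith
    qed
    have phi: "totient m = m div 2" using oy[OF x] by simp
    have "2 dvd m" using ev by presburger
    have "card {d. d dvd m} = 4" using 3 by (simp add: d_def)
    then have "m = 8"
    proof (cases rule: card_divisors_eq_4D)
      case (1 p)
      then have "p = 2" using \<open>2 dvd m\<close> by (metis prime_dvd_power primes_dvd_imp_eq two_is_prime_nat)
      then show ?thesis using 1 by simp
    next
      case (2 p q)
      \<comment> \<open>For an odd prime \<open>r\<close>, the totient of \<open>2 * r\<close> is
        \<open>r - 1\<close> rather than \<open>r\<close>.\<close>
      have False if "Factorial_Ring.prime r" "m = 2 * r" "r \<noteq> 2" for r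
      proof -
        have "coprime 2 r" using that two_is_prime_nat primes_coprime by metis
        then have "totient m = r - 1" using that by (simp add: totient_mult_coprime totient_prime)
        then show False using phi that prime_gt_0_nat[of r] by simp
      qed
      moreover have "p = 2 \<or> q = 2"
        using \<open>2 dvd m\<close> 2 by (metis prime_dvd_mult_iff primes_dvd_imp_eq two_is_prime_nat)
      ultimately show ?thesis using 2 by (metis mult.commute)
    qed
    then show ?thesis using not_all_outside_order_8[OF _ _ x] oy order t by simp
  qed
qed

end

section \<open>Isomorphism invariance and the model groups\<close>

lemma (in group) ord_iso:
  assumes "h \<in> iso G H" "group H" "x \<in> carrier G"
  shows "group.ord H (h x) = ord x"
proof -
  interpret H: group H by fact
  interpret h: group_hom G H h
    using assms(1) by (simp add: group_hom_def group_hom_axioms_def is_group H.is_group iso_def)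
  have inj: "inj_on h (carrier G)" using assms(1) by (simp add: iso_iff)
  have "h x [^]\<^bsub>H\<^esub> n = \<one>\<^bsub>H\<^esub> \<longleftrightarrow> ord x dvd n" for n :: nat
  proof -
    have "h x [^]\<^bsub>H\<^esub> n = \<one>\<^bsub>H\<^esub> \<longleftrightarrow> h (x [^] n) = h \<one>"
      using assms(3) by (simp add: h.hom_nat_pow)
    also have "\<dots> \<longleftrightarrow> x [^] n = \<one>" using inj_on_eq_iff[OF inj, of "x [^] n" \<one>] assms(3) by simp
    finally show ?thesis using assms(3) by (simp add: pow_eq_id)
  qed
  then show ?thesis using H.ord_unique[of "h x" "ord x"] assms(3) by simp
qed

lemma (in group) card_cyclic_subgroups_iso:
  assumes "finite (carrier G)" "group H" "G \<cong> H"
  shows "card (cyclic_subgroups G) = card (cyclic_subgroups H)"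
proof -
  interpret H: group H by fact
  obtain h where h: "h \<in> iso G H" using assms(3) by (auto simp: is_iso_def)
  then have bij: "bij_betw h (carrier G) (carrier H)" by (simp add: iso_def)
  then have finH: "finite (carrier H)" using assms(1) bij_betw_finite by blast
  have "(\<Sum>x\<in>carrier G. 1 / real (totient (ord x))) = (\<Sum>x\<in>carrier H. 1 / real (totient (H.ord x)))"
    by (rule sum.reindex_bij_betw[OF bij, symmetric, THEN trans, symmetric])
      (use ord_iso[OF h assms(2)] in simp)
  then show ?thesis
    using card_cyclic_subgroups[OF assms(1)] H.card_cyclic_subgroups[OF finH] by simp
qed

text \<open>The exponent map goes from residues to \<open>G\<close>, since powers of
  \<open>a\<close> depend only on the exponent modulo its order. It is onto, and both sides have the
  same size, so it is injective.\<close>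

lemma (in group) iso_integer_mod_group:
  assumes "finite (carrier G)" "a \<in> carrier G" "generate G {a} = carrier G"
  shows "G \<cong> integer_mod_group (ord a)"
proof -
  let ?n = "ord a" and ?f = "\<lambda>j::int. a [^] j"
  have n: "?n > 0" using ord_ge_1[OF assms(1,2)] by simp
  have hom: "?f \<in> hom (integer_mod_group ?n) G"
  proof (rule homI)
    fix i j
    have "a [^] ((i + j) mod int ?n) = a [^] (i + j)" by (rule int_pow_mod_ord[OF assms(2)])
    then show "a [^] (i \<otimes>\<^bsub>integer_mod_group ?n\<^esub> j) = a [^] i \<otimes> a [^] j"
      using assms(2) by (simp add: int_pow_mult)
  qed (use assms(2) in simp)
  have surj: "?f ` carrier (integer_mod_group ?n) = carrier G"
  proof
    show "carrier G \<subseteq> ?f ` carrier (integer_mod_group ?n)"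
    proof
      fix g assume "g \<in> carrier G"
      then have "g \<in> {a [^] k |k. k \<in> (UNIV :: int set)}"
        by (simp only: generate_pow[OF assms(2), symmetric] assms(3))
      then obtain k :: int where "g = a [^] k" by blast
      then have "g = ?f (k mod int ?n)" using int_pow_mod_ord[OF assms(2)] by simp
      moreover have "k mod int ?n \<in> carrier (integer_mod_group ?n)"
        using n by (simp add: carrier_integer_mod_group)
      ultimately show "g \<in> ?f ` carrier (integer_mod_group ?n)" by blast
    qed
  qed (use assms(2) in auto)
  moreover have "card (carrier G) = card (carrier (integer_mod_group ?n))"
    using generate_pow_card[OF assms(2)] assms(3) n by (simp add: carrier_integer_mod_group)
  ultimately have "inj_on ?f (carrier (integer_mod_group ?n))"
    using n by (intro eq_card_imp_inj_on) (auto simp: carrier_integer_mod_group)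
  then have "?f \<in> iso (integer_mod_group ?n) G"
    using hom surj by (simp add: iso_iff)
  then show ?thesis
    using group.iso_sym[OF group_integer_mod_group] is_isoI by blast
qed

text \<open>The residue 1 generates. The condition \<open>n > 1\<close> makes it a carrier element
  and keeps the group finite.\<close>

lemma card_cyclic_subgroups_integer_mod_group:
  assumes "n > 1"
  shows "card (cyclic_subgroups (integer_mod_group n)) = card {d. d dvd n}"
proof -
  let ?Z = "integer_mod_group n"
  interpret Z: group ?Z by simp
  have fin: "finite (carrier ?Z)" and one: "1 \<in> carrier ?Z"
    using assms by (auto simp: carrier_integer_mod_group)
  have "Z.ord 1 = n"
    using Z.ord_unique[OF one, of n] assms by (simp add: dvd_eq_mod_eq_0 of_nat_mod[symmetric] del: of_nat_mod)
  then have "card (generate ?Z {1}) = card (carrier ?Z)"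
    using Z.generate_pow_card[OF one] assms by (simp add: carrier_integer_mod_group)
  then have "generate ?Z {1} = carrier ?Z"
    using Z.generate_incl[of "{1}"] one fin by (intro card_subset_eq) auto
  then show ?thesis
    using Z.card_cyclic_subgroups[OF fin] Z.sum_generate_inverse_totient[OF fin one] \<open>Z.ord 1 = n\<close> by simp
qed

lemma nat_pow_DirProd:
  "(x, y) [^]\<^bsub>G \<times>\<times> H\<^esub> (n::nat) = (x [^]\<^bsub>G\<^esub> n, y [^]\<^bsub>H\<^esub> n)"
  by (induction n) (auto simp: nat_pow_def)

text \<open>One element of order 1, three of order 2 and four of order 4 contribute
  \<open>1 + 3 + 4 / 2\<close>.\<close>

lemma card_cyclic_subgroups_C2_C4:
  "card (cyclic_subgroups (integer_mod_group 2 \<times>\<times> integer_mod_group 4)) = 6"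
proof -
  let ?P = "integer_mod_group 2 \<times>\<times> integer_mod_group 4"
  interpret P: group ?P by (simp add: DirProd_group)
  have car: "carrier ?P = {(0,0),(0,1),(0,2),(0,3),(1,0),(1,1),(1,2),(1,3)}"
  proof -
    have "{0..<2::int} = {0, 1}" "{0..<4::int} = {0, 1, 2, 3}" by auto
    then show ?thesis by (auto simp: carrier_integer_mod_group)
  qed
  have ord: "P.ord z = d" if "z \<in> carrier ?P" "d > 0"
    "\<And>n::nat. z [^]\<^bsub>?P\<^esub> n = \<one>\<^bsub>?P\<^esub> \<longleftrightarrow> d dvd n" for z d
    using P.ord_unique[OF that(1), of d] that(3) by simp
  have o: "P.ord (i, j) = (if (i, j) = (0, 0) then 1 else if j = 0 \<or> j = 2 then 2 else 4)"
    if "(i, j) \<in> carrier ?P" for i j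
  proof (rule ord[OF that])
    fix n :: nat
    have "(i, j) [^]\<^bsub>?P\<^esub> n = \<one>\<^bsub>?P\<^esub> \<longleftrightarrow> int n * i mod 2 = 0 \<and> int n * j mod 4 = 0"
      by (simp add: nat_pow_DirProd)
    also have "\<dots> \<longleftrightarrow> (if (i, j) = (0, 0) then 1 else if j = 0 \<or> j = 2 then 2 else 4) dvd n"
      using that unfolding car by (elim insertE emptyE; simp; presburger)
    finally show "(i, j) [^]\<^bsub>?P\<^esub> n = \<one>\<^bsub>?P\<^esub> \<longleftrightarrow>
      (if (i, j) = (0, 0) then 1 else if j = 0 \<or> j = 2 then 2 else 4) dvd n" .
  qed simp
  have "real (card (cyclic_subgroups ?P)) = (\<Sum>z\<in>carrier ?P. 1 / real (totient (P.ord z)))"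
    by (rule P.card_cyclic_subgroups) (unfold car, simp)
  also have "\<dots> = (\<Sum>z\<in>carrier ?P. 1 / real (totient (if z = (0, 0) then 1 else if snd z = 0 \<or> snd z = 2 then 2 else 4)))"
  proof (rule sum.cong[OF refl])
    fix z assume "z \<in> carrier ?P"
    then show "1 / real (totient (P.ord z)) =
      1 / real (totient (if z = (0, 0) then 1 else if snd z = 0 \<or> snd z = 2 then 2 else 4))"
      using o[of "fst z" "snd z"] by (simp only: prod.collapse)
  qed
  also have "\<dots> = 6" unfolding car by simp
  finally show ?thesis by linarith
qed

section \<open>Recognition of the product of cyclic groups of orders 2 and 4\<close>

text \<open>The four elements outside \<open>M\<close> have order 2 or 4 and contribute 3, whereas
  equal orders would contribute 4 or 2. So there are \<open>x\<close> of order 2 and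
  \<open>y\<close> of order 4; \<open>x\<close> complements \<open>M\<close>, and \<open>y\<close>
  rules out that \<open>x\<close> inverts \<open>a\<close>.\<close>

lemma (in max_cyclic) iso_C2_C4:
  assumes "m = 4" "order G = 8" "card (cyclic_subgroups G) = 6"
  shows "G \<cong> integer_mod_group 2 \<times>\<times> integer_mod_group 4"
proof -
  have "card {d. d dvd m} = 3"
    using card_divisors_prime_power_mult[of 2 1 2] assms(1) by simp
  then have sum: "card (cyclic_subgroups G) = card {d. d dvd m} + 3" using assms(3) by simp
  have full: "i = 2" if "1 < i" "i * m \<le> order G" for i using that assms(1,2) by simp
  have ord_outside: "ord y = 2 \<or> ord y = 4" if y: "y \<in> carrier G - M" for y
  proof -
    obtain s where s: "ord y = 2 * s" "s dvd m" "s < m" "s > 0"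
      using outside_index_2[OF y] assms(1,2) by auto
    then have "s \<noteq> 3" using assms(1) by auto
    then have "s = 1 \<or> s = 2" using s assms(1) by linarith
    then show ?thesis using s by auto
  qed
  have "\<exists>x\<in>carrier G - M. ord x \<noteq> 4"
  proof (rule ccontr)
    assume "\<not> ?thesis"
    then have "totient (ord z) = 2" if "z \<in> carrier G - M" for z using that by simp
    then show False using card_outside_eq[OF sum, of 2] assms(1,2) by simp
  qed
  then obtain x where xo: "x \<in> carrier G - M" and ox: "ord x = 2" using ord_outside by blast
  have "\<exists>y\<in>carrier G - M. ord y \<noteq> 2"
  proof (rule ccontr)
    assume "\<not> ?thesis"
    then have "totient (ord z) = 1" if "z \<in> carrier G - M" for z using that by simp
    then show False using card_outside_eq[OF sum, of 1] assms(1,2) by simp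
  qed
  then obtain y where yo: "y \<in> carrier G - M" and oy: "ord y = 4" using ord_outside by blast
  have x [simp]: "x \<in> carrier G" using xo by simp
  have xx: "x \<otimes> x = \<one>" using ox pow_ord_eq_1[OF x] by (simp add: numeral_2_eq_2)
  have decomp: "\<exists>j<(2::nat). \<exists>n::nat. g = x [^] j \<otimes> a [^] n" if "g \<in> carrier G" for g
  proof -
    obtain i where i: "1 < i" "i * m \<le> order G"
      "i * m = order G \<Longrightarrow> carrier G = (\<lambda>(j, h). x [^] j \<otimes> h) ` ({..<i} \<times> M)"
      using outsideE[OF xo] by metis
    moreover have "i = 2" using full[OF i(1,2)] .
    ultimately have "carrier G = (\<lambda>(j, h). x [^] j \<otimes> h) ` ({..<(2::nat)} \<times> M)"
      using assms(1,2) by simp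
    then show ?thesis using that by (auto simp: M_eq)
  qed
  obtain k where k: "x \<otimes> a = a [^] (k::nat) \<otimes> x"
  proof (rule conjugate_generator[OF _ x])
    show "i * m = order G" if "1 < i" "i * m \<le> order G" for i
      using full[OF that] assms(1,2) by simp
  qed
  \<comment> \<open>Conjugating twice by the involution \<open>x\<close> fixes \<open>a\<close>, so
    \<open>k * k\<close> is 1 modulo 4.\<close>
  have "a [^] (k * k) = a [^] (k * k) \<otimes> (x \<otimes> x)" by (simp add: xx)
  also have "\<dots> = x \<otimes> (x \<otimes> a)" using mult_pow_commute[OF x a_closed k, of k] k by (simp add: m_assoc[symmetric])
  also have "\<dots> = a [^] (1::nat)" by (simp add: m_assoc[symmetric] xx)
  finally have "4 dvd int (k * k) - 1" using pow_eq_pow_iff[of a "k * k" 1] assms(1) by simp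
  then have odd: "odd (int (k * k))" by presburger
  then have odd: "odd k" by simp
  have "\<not> 4 dvd 1 + k"
  proof
    assume dvd: "4 dvd 1 + k"
    obtain j n :: nat where y: "j < 2" "y = x [^] j \<otimes> a [^] n" using decomp[of y] yo by auto
    \<comment> \<open>\<open>j = 0\<close> would place \<open>y\<close> in \<open>M\<close>. With
      \<open>j = 1\<close>, the square of \<open>y\<close> is a power of \<open>a\<close> whose
      exponent is a multiple of \<open>1 + k\<close>, so it is trivial.\<close>
    have "j \<noteq> 0" using y yo by (intro notI) (simp add: M_eq)
    then have "y = a [^] (k * n) \<otimes> x" using y mult_pow_commute[OF x a_closed k, of n] by (simp add: less_2_cases_iff)
    then have "y [^] (2::nat) = a [^] (k * n * (1 + k)) \<otimes> x [^] (2::nat)"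
      using pow_mult_square[OF x a_closed k] by simp
    also have "\<dots> = a [^] (k * n * (1 + k))" using xx by (simp add: numeral_2_eq_2)
    also have "\<dots> = \<one>" using dvd assms(1) pow_eq_id[OF a_closed] by (metis dvd_mult)
    finally have "ord y dvd 2" using yo pow_eq_id by simp
    then show False using oy by simp
  qed
  with odd have "4 dvd int k - int 1" by presburger
  then have "a [^] k = a [^] (1::nat)" using pow_eq_pow_iff[of a k 1] assms(1) by simp
  then have xa: "x \<otimes> a = a [^] (1::nat) \<otimes> x" using k by simp
  \<comment> \<open>\<open>mult_pow_commute\<close> is used twice: first for powers of
    \<open>a\<close>, then with \<open>x\<close> in the role of \<open>a\<close> for powers of
    \<open>x\<close>.\<close>
  have comm: "a [^] n \<otimes> x [^] j = x [^] j \<otimes> a [^] n" for j n :: nat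
    using mult_pow_commute[of "a [^] n" x 1 j] mult_pow_commute[OF x a_closed xa, of n] by simp
  let ?P = "integer_mod_group 2 \<times>\<times> integer_mod_group 4"
  \<comment> \<open>The residues are nonnegative integers, so \<open>nat\<close> preserves their
    values.\<close>
  let ?f = "\<lambda>(i, j). x [^] nat i \<otimes> a [^] nat j"
  have hom: "?f \<in> hom ?P G"
  proof (rule homI)
    show "?f u \<in> carrier G" for u by (simp add: case_prod_beta)
    fix u v assume uv: "u \<in> carrier ?P" "v \<in> carrier ?P"
    obtain i j i' j' where ij: "u = (i, j)" "v = (i', j')" by fastforce
    with uv have nonneg: "0 \<le> i" "0 \<le> i'" "0 \<le> j" "0 \<le> j'"
      by (auto simp: carrier_integer_mod_group)
    have "x [^] nat ((i + i') mod 2) = x [^] (nat i + nat i')"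
      unfolding pow_eq_pow_iff[OF x] ox using nonneg by simp
    moreover have "a [^] nat ((j + j') mod 4) = a [^] (nat j + nat j')"
      unfolding pow_eq_pow_iff[OF a_closed] assms(1) using nonneg by simp presburger
    ultimately have "x [^] nat ((i + i') mod 2) \<otimes> a [^] nat ((j + j') mod 4)
        = x [^] nat i \<otimes> (x [^] nat i' \<otimes> a [^] nat j) \<otimes> a [^] nat j'"
      by (simp add: nat_pow_mult[symmetric] m_assoc)
    also have "\<dots> = x [^] nat i \<otimes> (a [^] nat j \<otimes> x [^] nat i') \<otimes> a [^] nat j'"
      by (simp only: comm)
    also have "\<dots> = x [^] nat i \<otimes> a [^] nat j \<otimes> (x [^] nat i' \<otimes> a [^] nat j')"
      by (simp add: m_assoc)
    finally show "?f (u \<otimes>\<^bsub>?P\<^esub> v) = ?f u \<otimes> ?f v" by (simp add: ij)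
  qed
  have surj: "?f ` carrier ?P = carrier G"
  proof
    show "?f ` carrier ?P \<subseteq> carrier G" by auto
    show "carrier G \<subseteq> ?f ` carrier ?P"
    proof
      fix g assume "g \<in> carrier G"
      then obtain j n :: nat where g: "j < 2" "g = x [^] j \<otimes> a [^] n" using decomp by blast
      have "a [^] n = a [^] (n mod 4)"
        unfolding pow_eq_pow_iff[OF a_closed] assms(1) by presburger
      then have "g = ?f (int j, int (n mod 4))" using g by (simp add: nat_int del: of_nat_mod)
      moreover have "(int j, int (n mod 4)) \<in> carrier ?P"
        using g by (auto simp: carrier_integer_mod_group)
      ultimately show "g \<in> ?f ` carrier ?P" by blast
    qed
  qed
  have fin: "finite (carrier ?P)" by (simp add: carrier_integer_mod_group)
  have "card (carrier G) = card (carrier ?P)"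
    using assms(2) by (simp add: carrier_integer_mod_group order_def card_cartesian_product)
  then have "inj_on ?f (carrier ?P)" using surj fin by (intro eq_card_imp_inj_on) auto
  then have "?f \<in> iso ?P G" using hom surj by (simp add: iso_iff)
  then show ?thesis
    by (intro group.iso_sym[of ?P G] is_isoI DirProd_group group_integer_mod_group)
qed

section \<open>Classification of the groups with six cyclic subgroups\<close>

theorem theorem4p1:
  fixes G :: "('a, 'b) monoid_scheme"
  assumes "group G"
    and "finite (carrier G)"
  shows "card (cyclic_subgroups G) = 6 \<longleftrightarrow>
    (\<exists>p q :: nat. Factorial_Ring.prime p \<and> Factorial_Ring.prime q \<and> p < q \<and>
      (G \<cong> integer_mod_group (p ^ 5) \<or>
       G \<cong> integer_mod_group (p ^ 2 * q) \<or>
       G \<cong> integer_mod_group (p * q ^ 2) \<or>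
       G \<cong> integer_mod_group 2 \<times>\<times> integer_mod_group 4))"
    (is "_ \<longleftrightarrow> ?R")
proof
  interpret group G by fact
  assume six: "card (cyclic_subgroups G) = 6"
  have "carrier G \<noteq> {}" by blast
  then have "Max (ord ` carrier G) \<in> ord ` carrier G" using assms(2) by (intro Max_in) auto
  then obtain a where a: "a \<in> carrier G" "ord a = Max (ord ` carrier G)" by auto
  interpret max_cyclic G a
  proof
    show "ord x \<le> ord a" if "x \<in> carrier G" for x
      unfolding a(2) using that assms(2) by (intro Max_ge) auto
  qed (use a assms(2) in auto)
  show ?R
  proof (cases "M = carrier G")
    case True
    then have iso: "G \<cong> integer_mod_group m" by (intro iso_integer_mod_group) (simp_all add: fin)
    have "real (card (cyclic_subgroups G)) = real (card {d. d dvd m})"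
      using card_cyclic_subgroups[OF fin] sum_generate_inverse_totient[OF fin a_closed] True by simp
    then have "card {d. d dvd m} = 6" using six by simp
    then show ?thesis
    proof (cases rule: card_divisors_eq_6D)
      case (1 p)
      \<comment> \<open>The statement asks for a pair of primes; any larger prime completes
        it.\<close>
      obtain q where "Factorial_Ring.prime q" "p < q" using bigger_prime by blast
      then show ?thesis using 1 iso by auto
    next
      case (2 p q)
      \<comment> \<open>The order of the two primes decides which of the two mixed shapes
        applies.\<close>
      then have "p < q \<or> q < p" by linarith
      then show ?thesis using 2 iso by (metis mult.commute)
    qed
  next
    case False
    then have "G \<cong> integer_mod_group 2 \<times>\<times> integer_mod_group 4"
      using noncyclic_card_6[OF six] iso_C2_C4 six by simp
    \<comment> \<open>2 and 3 serve as the pair of primes to be exhibited.\<close>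
    moreover have "Factorial_Ring.prime (2::nat)" "Factorial_Ring.prime (3::nat)" "2 < (3::nat)" by auto
    ultimately show ?thesis by blast
  qed
next
  interpret group G by fact
  have cyclic: "card (cyclic_subgroups G) = card {d. d dvd n}"
    if "G \<cong> integer_mod_group n" "n > 1" for n
    using card_cyclic_subgroups_iso[OF assms(2) _ that(1)] card_cyclic_subgroups_integer_mod_group[OF that(2)]
    by simp
  assume ?R
  then obtain p q :: nat where pq: "Factorial_Ring.prime p" "Factorial_Ring.prime q" "p < q"
    and iso: "G \<cong> integer_mod_group (p ^ 5) \<or> G \<cong> integer_mod_group (p ^ 2 * q) \<or>
       G \<cong> integer_mod_group (p * q ^ 2) \<or> G \<cong> integer_mod_group 2 \<times>\<times> integer_mod_group 4"
    by blast
  have gt: "p > 1" "q > 1" using pq prime_gt_1_nat by auto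
  then have "1 < p ^ 5" "1 < p ^ 2" "1 < q ^ 2" by (simp_all only: one_less_power zero_less_numeral)
  then have gt: "1 < p ^ 5" "1 < p ^ 2 * q" "1 < q ^ 2 * p" using gt less_1_mult by blast+
  from iso show "card (cyclic_subgroups G) = 6"
  proof (elim disjE)
    assume "G \<cong> integer_mod_group (p ^ 5)"
    then show ?thesis using cyclic gt(1) card_divisors_prime_power_5[OF pq(1)] by simp
  next
    assume "G \<cong> integer_mod_group (p ^ 2 * q)"
    then show ?thesis using cyclic gt(2) card_divisors_prime_square_mult_prime[OF pq(1,2)] pq(3) by simp
  next
    assume "G \<cong> integer_mod_group (p * q ^ 2)"
    then show ?thesis
      using cyclic[of "q ^ 2 * p"] gt(3) card_divisors_prime_square_mult_prime[OF pq(2,1)] pq(3)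
      by (simp add: mult.commute)
  next
    assume "G \<cong> integer_mod_group 2 \<times>\<times> integer_mod_group 4"
    then have "card (cyclic_subgroups G) = card (cyclic_subgroups (integer_mod_group 2 \<times>\<times> integer_mod_group 4))"
      by (intro card_cyclic_subgroups_iso) (simp_all add: assms(2) DirProd_group)
    then show ?thesis by (simp only: card_cyclic_subgroups_C2_C4)
  qed
qed

end
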